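(* For any integer $t \ge 2$, any integer $N\ge 4$ and any reals $m,r$ satisfying $$\log m \ge t^{2t}(\log r)^{t} (\log N)^{1/t}\quad\text{and}\quad \log r \ge t\log \log N,$$ there exists an $(m,r)$-locally Ramsey graph on $N$ vertices.
   Context: All logarithms are base $2$. For a graph $G$ and reals $m,r>0$ (not necessarily integers), $G$ is called $(m,r)$-locally Ramsey if every set of at least $m$ vertices of $G$ contains both a clique and an independent set of size at least $r$. *)

theory Defs
  imports Complex_Main
begin

definition simple_graph :: "'a set \<Rightarrow> ('a \<Rightarrow> 'a \<Rightarrow> bool) \<Rightarrow> bool" where
  "simple_graph V E \<longleftrightarrow> finite V \<and>
     (\<forall>x\<in>V. \<forall>y\<in>V. E x y \<longrightarrow> E y x) \<and> (\<forall>x\<in>V. \<not> E x x)"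

definition is_clique :: "('a \<Rightarrow> 'a \<Rightarrow> bool) \<Rightarrow> 'a set \<Rightarrow> bool" where
  "is_clique E S \<longleftrightarrow> (\<forall>x\<in>S. \<forall>y\<in>S. x \<noteq> y \<longrightarrow> E x y)"

definition is_indep :: "('a \<Rightarrow> 'a \<Rightarrow> bool) \<Rightarrow> 'a set \<Rightarrow> bool" where
  "is_indep E S \<longleftrightarrow> (\<forall>x\<in>S. \<forall>y\<in>S. x \<noteq> y \<longrightarrow> \<not> E x y)"

definition locally_ramsey :: "'a set \<Rightarrow> ('a \<Rightarrow> 'a \<Rightarrow> bool) \<Rightarrow> real \<Rightarrow> real \<Rightarrow> bool" where
  "locally_ramsey V E m r \<longleftrightarrow>
     (\<forall>U\<subseteq>V. real (card U) \<ge> m \<longrightarrow>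
        (\<exists>K\<subseteq>U. is_clique E K \<and> real (card K) \<ge> r) \<and>
        (\<exists>I\<subseteq>U. is_indep E I \<and> real (card I) \<ge> r))"

end

theory Submission
  imports Defs "HOL-Library.FuncSet" "HOL-Library.Disjoint_Sets"
begin

text \<open>
  Induction on \<open>t\<close>, starting from \<open>t = 1\<close>, where \<open>m > N\<close>. Take a graph on about
  \<open>2 ^ (log N) powr (1 - 1/t)\<close> vertices supplied by the case \<open>t - 1\<close> and flip every pair
  independently with probability about \<open>1/r\<^sup>2\<close>. A set of size cubic in the old \<open>m\<close> contains so many
  edge-disjoint \<open>r\<close>-cliques that one survives, simultaneously for all such sets, while every
  homogeneous set of size polynomial in \<open>r\<close> is destroyed. In a lexicographic power of depth
  \<open>k \<approx> (log N) powr (1/t)\<close>, regarded as a tree, a vertex set either has at some node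
  sufficiently many children for an \<open>r\<close>-clique, or doubles its clique number at each node with
  polynomially many rich children; so it loses a factor polynomial in \<open>r\<close> for each of the
  \<open>k\<close> levels, but the expensive factor only \<open>log r\<close> times.
\<close>

section \<open>One colour of the Ramsey condition, with integer thresholds\<close>

text \<open>The other colour is the same predicate for \<open>\<lambda>x y. \<not> E x y\<close>, so
  each clique argument is done once and used twice. That the complement may hold on the diagonal is
  harmless, since \<open>is_clique\<close> compares distinct vertices only.\<close>

definition cliques_everywhere :: "'a set \<Rightarrow> ('a \<Rightarrow> 'a \<Rightarrow> bool) \<Rightarrow> nat \<Rightarrow> nat \<Rightarrow> bool" where
  "cliques_everywhere V E m r \<longleftrightarrow>
     (\<forall>U\<subseteq>V. card U \<ge> m \<longrightarrow> (\<exists>K\<subseteq>U. is_clique E K \<and> card K \<ge> r))"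

lemma cliques_everywhereD:
  assumes "cliques_everywhere V E m r" "U \<subseteq> V" "card U \<ge> m"
  obtains K where "K \<subseteq> U" "is_clique E K" "card K = r"
proof -
  obtain K where K: "K \<subseteq> U" "is_clique E K" "card K \<ge> r"
    using assms unfolding cliques_everywhere_def by blast
  obtain K' where "K' \<subseteq> K" "card K' = r"
    using obtain_subset_with_card_n[OF K(3)] by blast
  with K that[of K'] show ?thesis
    unfolding is_clique_def by blast
qed

lemma is_indep_iff_is_clique: "is_indep E S \<longleftrightarrow> is_clique (\<lambda>x y. \<not> E x y) S"
  by (simp add: is_indep_def is_clique_def)

subsection \<open>Lexicographic powers\<close>

text \<open>The first letter where two words differ decides adjacency. On words of length
  \<open>k\<close> this is the \<open>k\<close>-fold lexicographic product of the graph with itself;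
  equal words are never adjacent.\<close>

fun lex_power :: "('a \<Rightarrow> 'a \<Rightarrow> bool) \<Rightarrow> 'a list \<Rightarrow> 'a list \<Rightarrow> bool" where
  "lex_power E (x # xs) (y # ys) = (if x = y then lex_power E xs ys else E x y)"
| "lex_power E _ _ = False"

text \<open>The first difference decides both sides. Independent sets of the power are therefore
  cliques of the power of the complement.\<close>

lemma lex_power_complement:
  "length xs = length ys \<Longrightarrow> xs \<noteq> ys \<Longrightarrow>
     lex_power (\<lambda>x y. \<not> E x y) xs ys \<longleftrightarrow> \<not> lex_power E xs ys"
  by (induction xs ys rule: list_induct2) auto

lemma lex_power_sym:
  "length xs = length ys \<Longrightarrow> set xs \<subseteq> V \<Longrightarrow> set ys \<subseteq> V \<Longrightarrow>
     (\<And>x y. x \<in> V \<Longrightarrow> y \<in> V \<Longrightarrow> E x y \<Longrightarrow> E y x) \<Longrightarrow> lex_power E xs ys \<Longrightarrow> lex_power E ys xs"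
  by (induction xs ys rule: list_induct2) (auto split: if_splits)

lemma lex_power_irrefl: "\<not> lex_power E xs xs"
  by (induction xs) auto

text \<open>Words from different branches differ at the leading letter, where \<open>Q\<close>
  supplies adjacency; within a branch the leading letters cancel. Distinct leading letters also keep
  the branches disjoint, so sizes add.\<close>

lemma lex_power_clique_Union:
  assumes "finite Q" "is_clique E Q"
    and C: "\<And>v. v \<in> Q \<Longrightarrow> finite (C v) \<and> is_clique (lex_power E) (C v) \<and> c \<le> card (C v)"
  shows "is_clique (lex_power E) (\<Union>v\<in>Q. Cons v ` C v)"
    and "card Q * c \<le> card (\<Union>v\<in>Q. Cons v ` C v)"
proof -
  show "is_clique (lex_power E) (\<Union>v\<in>Q. Cons v ` C v)"
    using assms unfolding is_clique_def by auto
  have "card (\<Union>v\<in>Q. Cons v ` C v) = (\<Sum>v\<in>Q. card (Cons v ` C v))"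
    by (rule card_UN_disjoint) (use assms in auto)
  also have "\<dots> = (\<Sum>v\<in>Q. card (C v))"
    by (intro sum.cong refl card_image) auto
  also have "\<dots> \<ge> (\<Sum>v\<in>Q. c)"
    by (intro sum_mono) (use C in auto)
  finally show "card Q * c \<le> card (\<Union>v\<in>Q. Cons v ` C v)" by simp
qed

lemma cliques_everywhere_one:
  assumes "m > 0"
  shows "cliques_everywhere V E m (min 1 r)"
proof -
  have "\<exists>K\<subseteq>U. is_clique E K \<and> min 1 r \<le> card K" if "card U \<ge> m" for U
  proof -
    have "U \<noteq> {}" using that assms by auto
    then obtain u where "u \<in> U" by blast
    then have "{u} \<subseteq> U" "is_clique E {u}" "min 1 r \<le> card {u}"
      by (auto simp: is_clique_def)
    then show ?thesis by blast
  qed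
  then show ?thesis unfolding cliques_everywhere_def by blast
qed

text \<open>Induction on word length, splitting words by first letter, with \<open>s\<close>
  counting the doublings still wanted. Each level costs a factor \<open>h + 1\<close>, but a factor
  \<open>M\<close> is paid only when the target is halved, hence \<open>M ^ s\<close> and not
  \<open>M ^ k\<close>.\<close>

lemma cliques_everywhere_lex_power:
  assumes "finite V" and two: "cliques_everywhere V E h 2" and big: "cliques_everywhere V E M r"
    and "M \<ge> 2"
  shows "cliques_everywhere {xs. set xs \<subseteq> V \<and> length xs = k} (lex_power E)
           ((h + 1) ^ k * M ^ s) (min (2 ^ s) r)"
proof (induction k arbitrary: s)
  case 0
  show ?case
  proof (cases s)
    case 0
    have "(h + 1) ^ 0 * M ^ s > 0" "(2::nat) ^ s = 1" using 0 by simp_all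
    then show ?thesis by (metis cliques_everywhere_one)
  next
    case (Suc j)
    \<comment> \<open>There is a single word of length zero, so the claim is vacuous once the
      threshold \<open>M ^ s\<close> is at least 2.\<close>
    have "2 ^ s \<le> M ^ s" using \<open>M \<ge> 2\<close> by (rule power_mono) simp
    moreover have "(2::nat) ^ 1 \<le> 2 ^ s" using Suc by (intro power_increasing) auto
    ultimately have "2 \<le> M ^ s" by simp
    have "\<not> (h + 1) ^ 0 * M ^ s \<le> card U" if "U \<subseteq> {xs. set xs \<subseteq> V \<and> length xs = 0}" for U
    proof -
      have "U \<subseteq> {[]}" using that by auto
      then have "card U \<le> 1" using card_mono[of "{[]}" U] by simp
      with \<open>2 \<le> M ^ s\<close> show ?thesis by simp
    qed
    then show ?thesis unfolding cliques_everywhere_def by blast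
  qed
next
  case (Suc k)
  define g where "g s = (h + 1) ^ k * M ^ s" for s
  let ?L = "\<lambda>k. {xs. set xs \<subseteq> V \<and> length xs = k}"
  have g_pos: "g s > 0" for s using \<open>M \<ge> 2\<close> by (simp add: g_def)
  show ?case
  proof (cases s)
    case 0
    have "(h + 1) ^ Suc k * M ^ s > 0" "(2::nat) ^ s = 1" using 0 by simp_all
    then show ?thesis by (metis cliques_everywhere_one)
  next
    case s: (Suc j)
    have "\<exists>C\<subseteq>U. is_clique (lex_power E) C \<and> min (2 ^ s) r \<le> card C"
      if U: "U \<subseteq> ?L (Suc k)" and cU: "card U \<ge> (h + 1) ^ Suc k * M ^ s" for U
    proof -
      define W where "W v = {xs. v # xs \<in> U}" for v
      have W: "W v \<subseteq> ?L k" for v using U by (fastforce simp: W_def)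
      have finL: "finite (?L k)" by (rule finite_lists_length_eq[OF \<open>finite V\<close>])
      have finW: "finite (W v)" for v using W finL by (rule finite_subset)
      \<comment> \<open>\<open>X\<close> collects the letters whose branch already yields half the
        target, \<open>Y\<close> all first letters occurring in \<open>U\<close>.\<close>
      define X where "X = {v \<in> V. card (W v) \<ge> g j}"
      define Y where "Y = {v \<in> V. W v \<noteq> {}}"
      have "X \<subseteq> Y" using g_pos[of j] by (auto simp: X_def Y_def)
      have finY: "finite Y" using \<open>finite V\<close> by (simp add: Y_def)
      have ih: "\<exists>C\<subseteq>W v. is_clique (lex_power E) C \<and> min (2 ^ i) r \<le> card C"
        if "card (W v) \<ge> g i" for v i
        using Suc.IH[of i, unfolded cliques_everywhere_def, rule_format, OF W] that
        by (simp add: g_def)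
      have glue: "\<exists>C\<subseteq>U. is_clique (lex_power E) C \<and> n * c \<le> card C"
        if Q: "finite Q" "is_clique E Q" "card Q = n"
          and ex: "\<And>v. v \<in> Q \<Longrightarrow> \<exists>C\<subseteq>W v. is_clique (lex_power E) C \<and> c \<le> card C" for Q n c
      proof -
        obtain C where C: "\<And>v. v \<in> Q \<Longrightarrow> C v \<subseteq> W v \<and> is_clique (lex_power E) (C v) \<and> c \<le> card (C v)"
          using ex by metis
        have "(\<Union>v\<in>Q. Cons v ` C v) \<subseteq> U" using C by (fastforce simp: W_def)
        moreover have "is_clique (lex_power E) (\<Union>v\<in>Q. Cons v ` C v)"
          "card Q * c \<le> card (\<Union>v\<in>Q. Cons v ` C v)"
          by (rule lex_power_clique_Union; use Q C finW finite_subset in blast)+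
        ultimately show ?thesis using Q(3) by blast
      qed
      show ?thesis
      proof (cases "\<exists>v\<in>V. card (W v) \<ge> g s")
        case True
        then obtain v where v: "card (W v) \<ge> g s" by blast
        have "\<exists>C\<subseteq>U. is_clique (lex_power E) C \<and> 1 * min (2 ^ s) r \<le> card C"
          by (rule glue[of "{v}"]) (use ih[OF v] in \<open>auto simp: is_clique_def\<close>)
        then show ?thesis by simp
      next
        case small: False
        \<comment> \<open>Many rich branches give an edge joining two half-size cliques; many
          nonempty branches give an \<open>r\<close>-clique with one word per branch; otherwise
          \<open>U\<close> is too small.\<close>
        consider "card X \<ge> h" | "card Y \<ge> M" | "card X < h" "card Y < M" by linarith
        then show ?thesis
        proof cases
          case 1
          obtain Q where Q: "Q \<subseteq> X" "is_clique E Q" "card Q = 2"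
            using cliques_everywhereD[OF two _ 1] X_def by blast
          have "finite Q" using Q(3) card.infinite by fastforce
          then have "\<exists>C\<subseteq>U. is_clique (lex_power E) C \<and> 2 * min (2 ^ j) r \<le> card C"
            by (rule glue[OF _ Q(2,3)]) (use ih Q(1) X_def in blast)
          moreover have "min (2 ^ s) r \<le> 2 * min (2 ^ j) r" by (simp add: s min_def)
          ultimately show ?thesis using order_trans by blast
        next
          case 2
          obtain Q where Q: "Q \<subseteq> Y" "is_clique E Q" "card Q = r"
            using cliques_everywhereD[OF big _ 2] Y_def by blast
          have "\<exists>C\<subseteq>W v. is_clique (lex_power E) C \<and> 1 \<le> card C" if v: "v \<in> Q" for v
          proof -
            obtain w where "w \<in> W v" using v Q(1) Y_def by blast
            then show ?thesis by (intro exI[of _ "{w}"]) (auto simp: is_clique_def)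
          qed
          then have "\<exists>C\<subseteq>U. is_clique (lex_power E) C \<and> r * 1 \<le> card C"
            by (rule glue[OF finite_subset[OF Q(1) finY] Q(2,3)])
          then show ?thesis by (auto intro: le_trans[OF min.cobounded2])
        next
          case 3
          have "U \<subseteq> (\<Union>v\<in>Y. Cons v ` W v)"
          proof
            fix u assume "u \<in> U"
            moreover from this obtain v w where "u = v # w" "v \<in> V"
              using U by (cases u) auto
            ultimately show "u \<in> (\<Union>v\<in>Y. Cons v ` W v)" by (auto simp: Y_def W_def)
          qed
          then have "card U \<le> card (\<Union>v\<in>Y. Cons v ` W v)"
            by (rule card_mono[rotated]) (use finY finW in auto)
          also have "\<dots> \<le> (\<Sum>v\<in>Y. card (Cons v ` W v))" by (rule card_UN_le[OF finY])
          also have "\<dots> = (\<Sum>v\<in>Y. card (W v))" by (intro sum.cong refl card_image) auto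
          also have "\<dots> \<le> (\<Sum>v\<in>Y. if v \<in> X then g s else g j)"
            using small by (intro sum_mono) (auto simp: X_def Y_def not_le intro: less_imp_le)
          also have "\<dots> = card X * g s + card (Y - X) * g j"
            using finY \<open>X \<subseteq> Y\<close> by (simp add: sum.If_cases Int_absorb1 Diff_eq)
          also have "\<dots> < h * g s + M * g j"
          proof (rule add_le_less_mono)
            show "card X * g s \<le> h * g s" using 3 by simp
            have "card (Y - X) \<le> card Y" by (rule card_mono) (use finY in auto)
            then show "card (Y - X) * g j < M * g j" using 3 g_pos[of j] by simp
          qed
          \<comment> \<open>Since \<open>M * g j = g s\<close>, all light branches together cost one
            more copy of \<open>g s\<close>: this is the \<open>+ 1\<close> in
            \<open>h + 1\<close>.\<close>
          also have "\<dots> = (h + 1) ^ Suc k * M ^ s" by (simp add: g_def s algebra_simps)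
          finally show ?thesis using cU by simp
        qed
      qed
    qed
    then show ?thesis unfolding cliques_everywhere_def by blast
  qed
qed

subsection \<open>Random perturbation\<close>

text \<open>The sets are the lines of slope below \<open>A\<close> in an \<open>m\<close> by \<open>2 * A * m\<close> grid.\<close>

lemma exists_almost_disjoint_subsets:
  fixes U :: "'a set" and m A :: nat
  assumes "card U = 2 * A * m\<^sup>2" "finite U"
  obtains L :: "nat \<times> nat \<Rightarrow> 'a set" where
    "\<And>p. p \<in> {..<A} \<times> {..<A * m} \<Longrightarrow> L p \<subseteq> U \<and> card (L p) = m"
    "\<And>p p'. p \<noteq> p' \<Longrightarrow> p \<in> {..<A} \<times> {..<A * m} \<Longrightarrow> p' \<in> {..<A} \<times> {..<A * m} \<Longrightarrow> card (L p \<inter> L p') \<le> 1"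
proof -
  let ?G = "{..<m} \<times> {..<2 * A * m}"
  have "card ?G = card U" using assms by (simp add: power2_eq_square)
  then obtain \<phi> where \<phi>: "bij_betw \<phi> ?G U"
    using finite_same_card_bij[of ?G U] assms by auto
  define l where "l p = (\<lambda>i. (i, fst p * i + snd p)) ` {..<m}" for p :: "nat \<times> nat"
  have l: "l p \<subseteq> ?G" if "p \<in> {..<A} \<times> {..<A * m}" for p
  proof -
    have "fst p * i + snd p < 2 * A * m" if "i < m" for i
    proof -
      have "fst p * i \<le> A * m" using that \<open>p \<in> _\<close> by (intro mult_mono) auto
      moreover have "snd p < A * m" using \<open>p \<in> _\<close> by auto
      ultimately show ?thesis by linarith
    qed
    then show ?thesis by (auto simp: l_def)
  qed
  have inj: "inj_on \<phi> ?G" using \<phi> by (rule bij_betw_imp_inj_on)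
  show ?thesis
  proof (rule that[of "\<lambda>p. \<phi> ` l p"])
    fix p assume p: "p \<in> {..<A} \<times> {..<A * m}"
    have "card (\<phi> ` l p) = card (l p)"
      by (rule card_image) (rule inj_on_subset[OF inj l[OF p]])
    also have "\<dots> = m" unfolding l_def by (subst card_image) (auto simp: inj_on_def)
    finally show "\<phi> ` l p \<subseteq> U \<and> card (\<phi> ` l p) = m"
      using l[OF p] bij_betw_imp_surj_on[OF \<phi>] by blast
  next
    fix p p' assume ne: "p \<noteq> p'" and p: "p \<in> {..<A} \<times> {..<A * m}" "p' \<in> {..<A} \<times> {..<A * m}"
    have "u = v" if "u \<in> l p \<inter> l p'" "v \<in> l p \<inter> l p'" for u v
    proof -
      from that obtain i j where ij: "u = (i, fst p * i + snd p)" "v = (j, fst p * j + snd p)"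
        "fst p * i + snd p = fst p' * i + snd p'" "fst p * j + snd p = fst p' * j + snd p'"
        by (auto simp: l_def)
      \<comment> \<open>Two common points make slope difference times abscissa difference vanish.
        The slopes differ, because lines of equal slope with a common point coincide.\<close>
      have "(int (fst p) - int (fst p')) * (int i - int j) = 0"
        using arg_cong[OF ij(3), of int] arg_cong[OF ij(4), of int] by (simp add: algebra_simps)
      moreover have "fst p \<noteq> fst p'" using ij(3) ne by (auto simp: prod_eq_iff)
      ultimately show ?thesis using ij by simp
    qed
    then have "card (l p \<inter> l p') \<le> 1"
      by (metis card_le_Suc0_iff_eq One_nat_def finite_Int finite_imageI finite_lessThan l_def)
    moreover have "\<phi> ` l p \<inter> \<phi> ` l p' = \<phi> ` (l p \<inter> l p')"
      using inj_on_image_Int[OF inj l[OF p(1)] l[OF p(2)]] by simp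
    ultimately show "card (\<phi> ` l p \<inter> \<phi> ` l p') \<le> 1"
      by (metis card_image_le finite_Int finite_imageI finite_lessThan l_def order_trans)
  qed
qed

section \<open>Counting functions that vanish somewhere on given blocks\<close>

text \<open>Union bound: a uniform \<open>f\<close> vanishes at a given point with probability 1/q,
  hence somewhere on \<open>S\<close> with probability at most 1/2.\<close>

lemma card_PiE_hitting_zero:
  fixes q :: nat
  assumes "finite S" "2 * card S \<le> q"
  shows "2 * card {f \<in> S \<rightarrow>\<^sub>E {..<q}. \<exists>e\<in>S. f e = 0} \<le> q ^ card S"
proof (cases "S = {}")
  case True
  then show ?thesis by simp
next
  case False
  have "{f \<in> S \<rightarrow>\<^sub>E {..<q}. \<exists>e\<in>S. f e = 0} \<subseteq> (\<Union>e\<in>S. PiE S (\<lambda>e'. if e' = e then {0} else {..<q}))"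
    by (fastforce simp: PiE_iff)
  then have "card {f \<in> S \<rightarrow>\<^sub>E {..<q}. \<exists>e\<in>S. f e = 0} \<le> card (\<Union>e\<in>S. PiE S (\<lambda>e'. if e' = e then {0} else {..<q}))"
    by (rule card_mono[rotated]) (auto intro!: finite_PiE assms)
  also have "\<dots> \<le> (\<Sum>e\<in>S. card (PiE S (\<lambda>e'. if e' = e then {0} else {..<q})))"
    by (rule card_UN_le[OF assms(1)])
  also have "\<dots> = (\<Sum>e\<in>S. q ^ (card S - 1))"
  proof (rule sum.cong[OF refl])
    fix e assume "e \<in> S"
    have "card (PiE S (\<lambda>e'. if e' = e then {0} else {..<q})) = (\<Prod>e'\<in>S. if e' = e then 1 else q)"
      by (subst card_PiE[OF assms(1)]) (auto intro!: prod.cong)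
    also have "\<dots> = q ^ (card S - 1)"
      using \<open>e \<in> S\<close> assms(1) by (simp add: prod.remove[of S e] card_Diff_singleton)
    finally show "card (PiE S (\<lambda>e'. if e' = e then {0} else {..<q})) = q ^ (card S - 1)" .
  qed
  finally have "2 * card {f \<in> S \<rightarrow>\<^sub>E {..<q}. \<exists>e\<in>S. f e = 0} \<le> (2 * card S) * q ^ (card S - 1)" by simp
  also have "\<dots> \<le> q * q ^ (card S - 1)" using assms(2) by simp
  also have "\<dots> = q ^ card S" using False assms(1) by (metis card_gt_0_iff power_minus_mult mult.commute)
  finally show ?thesis .
qed

text \<open>Values on disjoint blocks are independent, so the probabilities 1/2 of the previous
  bound multiply. The induction splits off one block at a time.\<close>

lemma card_PiE_all_hitting_zero:
  fixes q :: nat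
  assumes "finite I" "finite P" "\<And>i. i \<in> I \<Longrightarrow> S i \<subseteq> P" "disjoint_family_on S I"
    and "\<And>i. i \<in> I \<Longrightarrow> 2 * card (S i) \<le> q"
  shows "2 ^ card I * card {f \<in> P \<rightarrow>\<^sub>E {..<q}. \<forall>i\<in>I. \<exists>e\<in>S i. f e = 0} \<le> q ^ card P"
  using assms
proof (induction I arbitrary: P rule: finite_induct)
  case empty
  then show ?case by (simp add: card_PiE)
next
  case (insert i I)
  let ?B = "\<lambda>I P. {f \<in> P \<rightarrow>\<^sub>E {..<q}. \<forall>i\<in>I. \<exists>e\<in>S i. f e = 0}"
  have Si: "S i \<subseteq> P" using insert.prems by auto
  then have fin_Si: "finite (S i)" using insert.prems(1) by (rule finite_subset)
  have disj: "S j \<inter> S i = {}" if "j \<in> I" for j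
    using insert that by (auto simp: disjoint_family_on_def)
  \<comment> \<open>The restrictions to the block and to the rest determine \<open>f\<close>;
    injectivity of this map is all the independence that an upper bound needs.\<close>
  let ?\<Phi> = "\<lambda>f. (restrict f (S i), restrict f (P - S i))"
  have "inj_on ?\<Phi> (?B (insert i I) P)"
  proof (rule inj_onI)
    fix f g assume fg: "f \<in> ?B (insert i I) P" "g \<in> ?B (insert i I) P" "?\<Phi> f = ?\<Phi> g"
    show "f = g"
    proof (rule PiE_ext)
      show "f \<in> P \<rightarrow>\<^sub>E {..<q}" "g \<in> P \<rightarrow>\<^sub>E {..<q}" using fg by auto
      fix x assume "x \<in> P"
      then show "f x = g x"
        using fg(3) by (metis DiffI prod.inject restrict_apply')
    qed
  qed
  moreover have "?\<Phi> ` ?B (insert i I) P \<subseteq> ?B {i} (S i) \<times> ?B I (P - S i)"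
  proof (rule image_subsetI)
    fix f assume f: "f \<in> ?B (insert i I) P"
    have "restrict f (S i) \<in> ?B {i} (S i)" using f Si by (auto simp: PiE_iff)
    moreover have "\<exists>e\<in>S j. restrict f (P - S i) e = 0" if j: "j \<in> I" for j
    proof -
      obtain e where "e \<in> S j" "f e = 0" using f j by blast
      moreover have "e \<in> P - S i" using \<open>e \<in> S j\<close> disj[OF j] insert.prems(2) j by blast
      ultimately show ?thesis by auto
    qed
    then have "restrict f (P - S i) \<in> ?B I (P - S i)" using f by (auto simp: PiE_iff)
    ultimately show "?\<Phi> f \<in> ?B {i} (S i) \<times> ?B I (P - S i)" by blast
  qed
  moreover have "finite (?B {i} (S i) \<times> ?B I (P - S i))"
    using fin_Si insert.prems(1) by (intro finite_SigmaI finite_subset[OF Collect_restrict] finite_PiE) auto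
  ultimately have "card (?B (insert i I) P) \<le> card (?B {i} (S i) \<times> ?B I (P - S i))"
    by (rule card_inj_on_le)
  then have "card (?B (insert i I) P) \<le> card (?B {i} (S i)) * card (?B I (P - S i))"
    by (simp add: card_cartesian_product)
  then have "2 ^ card (insert i I) * card (?B (insert i I) P)
      \<le> (2 * card (?B {i} (S i))) * (2 ^ card I * card (?B I (P - S i)))"
    using insert.hyps by (simp add: algebra_simps)
  also have "\<dots> \<le> q ^ card (S i) * q ^ card (P - S i)"
  proof (rule mult_mono)
    show "2 * card (?B {i} (S i)) \<le> q ^ card (S i)"
      using card_PiE_hitting_zero[OF fin_Si] insert.prems(4) by simp
    show "2 ^ card I * card (?B I (P - S i)) \<le> q ^ card (P - S i)"
    proof (rule insert.IH)
      show "disjoint_family_on S I" using insert.prems(3) by (auto simp: disjoint_family_on_def)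
      show "S j \<subseteq> P - S i" if "j \<in> I" for j using disj[OF that] insert.prems(2) that by blast
    qed (use insert.prems in auto)
  qed auto
  also have "\<dots> = q ^ card P"
    using Si fin_Si insert.prems(1)
    by (metis power_add card_Diff_subset card_mono le_add_diff_inverse)
  finally show ?case .
qed


section \<open>Probability bounds for randomly flipped pairs\<close>

abbreviation pairs :: "'a set \<Rightarrow> 'a set set" where
  "pairs V \<equiv> {e. e \<subseteq> V \<and> card e = 2}"

text \<open>
  A uniform choice of \<open>f\<close> with values below \<open>q\<close> flips each pair with probability \<open>1/q\<close>;
  probabilities are expressed as cardinalities of sets of such \<open>f\<close>.
\<close>

definition flip :: "('a \<Rightarrow> 'a \<Rightarrow> bool) \<Rightarrow> ('a set \<Rightarrow> nat) \<Rightarrow> 'a \<Rightarrow> 'a \<Rightarrow> bool" where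
  "flip E f x y \<longleftrightarrow> E x y \<noteq> (f {x, y} = 0)"

lemma flip_complement: "flip (\<lambda>x y. \<not> E x y) f = (\<lambda>x y. \<not> flip E f x y)"
  by (auto simp: flip_def fun_eq_iff)

lemma finite_pairs: "finite V \<Longrightarrow> finite (pairs V)"
  by (rule finite_subset[of _ "Pow V"]) auto

lemma card_pairs: "finite V \<Longrightarrow> card (pairs V) = card V choose 2"
  by (rule n_subsets)

text \<open>Each of the \<open>A * (A * m)\<close> lines in \<open>U\<close> contains an
  \<open>R\<close>-clique of \<open>F\<close>. Lines share at most one vertex, so these cliques have
  disjoint pair sets, and each has at most \<open>q\<close>/2 pairs, so some pair of it is flipped
  with probability at most 1/2. Without a surviving clique this happens to all of them.\<close>

lemma card_flips_without_clique:
  assumes "finite V" "cliques_everywhere V F m R" "R * (R - 1) \<le> q"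
    and U: "U \<subseteq> V" "card U = 2 * A * m\<^sup>2"
  shows "2 ^ (A * (A * m)) * card {f \<in> pairs V \<rightarrow>\<^sub>E {..<q}. \<not> (\<exists>K\<subseteq>U. is_clique (flip F f) K \<and> card K \<ge> R)}
           \<le> q ^ card (pairs V)"
proof -
  have "finite U" using U(1) assms(1) by (rule finite_subset)
  let ?I = "{..<A} \<times> {..<A * m}"
  obtain L where L: "\<And>p. p \<in> ?I \<Longrightarrow> L p \<subseteq> U \<and> card (L p) = m"
    "\<And>p p'. p \<noteq> p' \<Longrightarrow> p \<in> ?I \<Longrightarrow> p' \<in> ?I \<Longrightarrow> card (L p \<inter> L p') \<le> 1"
    using exists_almost_disjoint_subsets[OF U(2) \<open>finite U\<close>] by metis
  have "\<exists>K. K \<subseteq> L p \<and> is_clique F K \<and> card K = R" if "p \<in> ?I" for p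
    using cliques_everywhereD[OF assms(2), of "L p"] L(1)[OF that] U(1)
    by (metis order.refl subset_trans)
  then obtain K where K: "\<And>p. p \<in> ?I \<Longrightarrow> K p \<subseteq> L p \<and> is_clique F (K p) \<and> card (K p) = R"
    by metis
  have finK: "finite (K p)" if "p \<in> ?I" for p
    using K[OF that] L(1)[OF that] \<open>finite U\<close> by (meson finite_subset)
  have "2 ^ card ?I * card {f \<in> pairs V \<rightarrow>\<^sub>E {..<q}. \<forall>p\<in>?I. \<exists>e\<in>pairs (K p). f e = 0}
      \<le> q ^ card (pairs V)"
  proof (rule card_PiE_all_hitting_zero)
    show "finite (pairs V)" using finite_pairs assms(1) .
    show "pairs (K p) \<subseteq> pairs V" if "p \<in> ?I" for p
      using K[OF that] L(1)[OF that] U(1) by blast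
    show "2 * card (pairs (K p)) \<le> q" if "p \<in> ?I" for p
    proof -
      have "2 * card (pairs (K p)) = 2 * (R * (R - 1) div 2)"
        using K[OF that] unfolding card_pairs[OF finK[OF that]] choose_two by simp
      also have "\<dots> \<le> R * (R - 1)" by (rule times_div_less_eq_dividend)
      finally show ?thesis using assms(3) by (rule order_trans)
    qed
    have "pairs (K p) \<inter> pairs (K p') = {}" if p: "p \<in> ?I" "p' \<in> ?I" "p \<noteq> p'" for p p'
    proof (rule ccontr)
      assume "pairs (K p) \<inter> pairs (K p') \<noteq> {}"
      then obtain e where "e \<subseteq> K p" "e \<subseteq> K p'" and "card e = 2" by blast
      moreover have "K p \<subseteq> L p" "K p' \<subseteq> L p'" using K p by simp_all
      ultimately have e: "e \<subseteq> L p \<inter> L p'" "card e = 2" by auto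
      have "finite (L p \<inter> L p')" using L(1)[OF p(1)] \<open>finite U\<close> by (meson finite_Int finite_subset)
      then have "2 \<le> card (L p \<inter> L p')" using card_mono e by metis
      then show False using L(2)[OF p(3,1,2)] by simp
    qed
    then show "disjoint_family_on (\<lambda>p. pairs (K p)) ?I"
      by (simp add: disjoint_family_on_def)
  qed simp
  moreover have "card {f \<in> pairs V \<rightarrow>\<^sub>E {..<q}. \<not> (\<exists>K\<subseteq>U. is_clique (flip F f) K \<and> card K \<ge> R)}
      \<le> card {f \<in> pairs V \<rightarrow>\<^sub>E {..<q}. \<forall>p\<in>?I. \<exists>e\<in>pairs (K p). f e = 0}"
  proof (rule card_mono)
    show "finite {f \<in> pairs V \<rightarrow>\<^sub>E {..<q}. \<forall>p\<in>?I. \<exists>e\<in>pairs (K p). f e = 0}"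
      by (intro finite_subset[OF Collect_restrict] finite_PiE finite_pairs assms) simp
    show "{f \<in> pairs V \<rightarrow>\<^sub>E {..<q}. \<not> (\<exists>K\<subseteq>U. is_clique (flip F f) K \<and> card K \<ge> R)}
      \<subseteq> {f \<in> pairs V \<rightarrow>\<^sub>E {..<q}. \<forall>p\<in>?I. \<exists>e\<in>pairs (K p). f e = 0}"
    proof safe
      fix f i j
      assume none: "\<not> (\<exists>K\<subseteq>U. is_clique (flip F f) K \<and> card K \<ge> R)" and ij: "i < A" "j < A * m"
      then have p: "(i, j) \<in> ?I" by simp
      show "\<exists>e\<in>pairs (K (i, j)). f e = 0"
      proof (rule ccontr)
        assume no: "\<not> ?thesis"
        have "flip F f x y" if "x \<in> K (i, j)" "y \<in> K (i, j)" "x \<noteq> y" for x y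
        proof -
          have "{x, y} \<in> pairs (K (i, j))" using that by simp
          then have "f {x, y} \<noteq> 0" using no by meson
          moreover have "F x y" using conjunct1[OF conjunct2[OF K[OF p]]] that unfolding is_clique_def by simp
          ultimately show ?thesis by (simp add: flip_def)
        qed
        then have "is_clique (flip F f) (K (i, j))" by (simp add: is_clique_def)
        moreover have "K (i, j) \<subseteq> U" "card (K (i, j)) \<ge> R" using K[OF p] L(1)[OF p] by (meson order_trans, simp)
        ultimately show False using none by meson
      qed
    qed
  qed
  ultimately show ?thesis
    by (simp add: card_cartesian_product) (meson le_trans mult_le_mono2)
qed

text \<open>On a pair inside \<open>S\<close> the value of \<open>f\<close> must be nonzero if
  \<open>F\<close> has that edge and zero if not; either way at most \<open>q - 1\<close> values
  remain, as \<open>q \<ge> 2\<close>. Pairs not inside \<open>S\<close> are free.\<close>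

lemma card_flips_to_clique:
  assumes "finite V" "S \<subseteq> V" "q \<ge> 2"
  shows "card {f \<in> pairs V \<rightarrow>\<^sub>E {..<q}. is_clique (flip F f) S} * q ^ card (pairs S)
           \<le> (q - 1) ^ card (pairs S) * q ^ card (pairs V)"
proof -
  \<comment> \<open>\<open>D e\<close> holds the values allowed at \<open>e\<close>; quantifying
    over both orderings of the pair covers an \<open>F\<close> that is not symmetric.\<close>
  define D where "D e = {c \<in> {..<q}. \<forall>x y. e = {x, y} \<longrightarrow> x \<noteq> y \<longrightarrow> F x y \<noteq> (c = 0)}" for e
  have sub: "pairs S \<subseteq> pairs V" using assms(2) by auto
  have D: "card (D e) \<le> q - 1" if "e \<in> pairs S" for e
  proof -
    obtain x y where xy: "e = {x, y}" "x \<noteq> y" using \<open>e \<in> pairs S\<close> by (auto simp: card_2_iff)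
    have "D e \<subseteq> (if F x y then {1..<q} else {0})" using xy by (auto simp: D_def)
    then have "card (D e) \<le> card (if F x y then {1..<q} else {0})" by (rule card_mono[rotated]) simp
    also have "\<dots> \<le> q - 1" using assms(3) by auto
    finally show ?thesis .
  qed
  have "{f \<in> pairs V \<rightarrow>\<^sub>E {..<q}. is_clique (flip F f) S}
      \<subseteq> PiE (pairs V) (\<lambda>e. if e \<in> pairs S then D e else {..<q})"
  proof
    fix f assume f: "f \<in> {f \<in> pairs V \<rightarrow>\<^sub>E {..<q}. is_clique (flip F f) S}"
    have "f e \<in> D e" if e: "e \<in> pairs S" for e
    proof -
      have "F x y \<noteq> (f e = 0)" if "e = {x, y}" "x \<noteq> y" for x y
        using f e that by (auto simp: is_clique_def flip_def)
      then show ?thesis using f e sub by (auto simp: D_def PiE_iff)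
    qed
    then show "f \<in> PiE (pairs V) (\<lambda>e. if e \<in> pairs S then D e else {..<q})"
      using f by (auto simp: PiE_iff)
  qed
  then have "card {f \<in> pairs V \<rightarrow>\<^sub>E {..<q}. is_clique (flip F f) S}
      \<le> card (PiE (pairs V) (\<lambda>e. if e \<in> pairs S then D e else {..<q}))"
    by (rule card_mono[rotated]) (auto intro!: finite_PiE finite_pairs assms simp: D_def)
  also have "\<dots> = (\<Prod>e\<in>pairs V. card (if e \<in> pairs S then D e else {..<q}))"
    by (rule card_PiE) (rule finite_pairs[OF assms(1)])
  also have "\<dots> \<le> (\<Prod>e\<in>pairs V. if e \<in> pairs S then q - 1 else q)"
    by (intro prod_mono) (use D in auto)
  also have "\<dots> = (q - 1) ^ card (pairs V \<inter> pairs S) * q ^ card (pairs V \<inter> - pairs S)"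
    by (subst prod.If_cases) (use finite_pairs[OF assms(1)] in auto)
  also have "pairs V \<inter> pairs S = pairs S" using sub by blast
  also have "pairs V \<inter> - pairs S = pairs V - pairs S" by blast
  finally have "card {f \<in> pairs V \<rightarrow>\<^sub>E {..<q}. is_clique (flip F f) S} * q ^ card (pairs S)
      \<le> (q - 1) ^ card (pairs S) * (q ^ card (pairs V - pairs S) * q ^ card (pairs S))"
    by (simp add: mult.assoc[symmetric])
  also have "q ^ card (pairs V - pairs S) * q ^ card (pairs S) = q ^ card (pairs V)"
    using sub finite_pairs[OF assms(1)] finite_subset[OF sub]
    by (metis (no_types, lifting) power_add card_Diff_subset card_mono le_add_diff_inverse2)
  finally show ?thesis .
qed

text \<open>This is (1 - 1/q)^q \<le> 1/2. With \<open>q = Suc p\<close>, the expansion of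
  \<open>(p + 1) ^ q\<close> contains \<open>p ^ q\<close> and \<open>q * p ^ p\<close>, and the
  second is at least the first.\<close>

lemma two_mult_pred_power_le:
  fixes q :: nat
  assumes "q \<ge> 1"
  shows "2 * (q - 1) ^ q \<le> q ^ q"
proof -
  obtain p where p: "q = Suc p" using assms by (cases q) auto
  have "p ^ q + q * p ^ p \<le> (p + 1) ^ q"
  proof -
    have "(p + 1) ^ q = (\<Sum>k\<le>q. (q choose k) * p ^ k)" using binomial[of p 1 q] by simp
    also have "\<dots> \<ge> (\<Sum>k\<in>{p, q}. (q choose k) * p ^ k)"
      by (rule sum_mono2) (auto simp: p)
    finally show ?thesis by (simp add: p)
  qed
  moreover have "p ^ q \<le> q * p ^ p" by (simp add: p)
  ultimately show ?thesis by (simp add: p)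
qed

text \<open>The size \<open>4 * q * a\<close> makes the number of pairs in \<open>S\<close> equal to
  \<open>q\<close> times the exponent of 2, so the bound 1/2 per \<open>q\<close> pairs applies that
  many times.\<close>

lemma card_flips_to_large_clique:
  assumes "finite V" "S \<subseteq> V" "q \<ge> 2" "card S = 4 * q * a"
  shows "2 ^ (2 * a * (card S - 1)) * card {f \<in> pairs V \<rightarrow>\<^sub>E {..<q}. is_clique (flip F f) S}
           \<le> q ^ card (pairs V)"
proof -
  let ?c = "2 * a * (card S - 1)" and ?B = "{f \<in> pairs V \<rightarrow>\<^sub>E {..<q}. is_clique (flip F f) S}"
  have "finite S" using assms finite_subset by blast
  have "card S * (card S - 1) = 2 * (q * ?c)" using assms(4) by simp
  then have e: "card (pairs S) = q * ?c"
    unfolding card_pairs[OF \<open>finite S\<close>] choose_two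
    by (simp only: nonzero_mult_div_cancel_left[of "2::nat"])
  have "2 ^ ?c * (q - 1) ^ (q * ?c) = (2 * (q - 1) ^ q) ^ ?c"
    by (simp only: power_mult_distrib power_mult)
  also have "\<dots> \<le> (q ^ q) ^ ?c"
    by (rule power_mono) (use two_mult_pred_power_le[of q] assms(3) in auto)
  finally have *: "2 ^ ?c * (q - 1) ^ (q * ?c) \<le> q ^ (q * ?c)" by (simp only: power_mult)
  have "(2 ^ ?c * card ?B) * q ^ (q * ?c) \<le> 2 ^ ?c * ((q - 1) ^ (q * ?c) * q ^ card (pairs V))"
    using card_flips_to_clique[OF assms(1-3), of F] unfolding e by (simp only: mult.assoc) simp
  also have "\<dots> \<le> q ^ (q * ?c) * q ^ card (pairs V)"
    using mult_le_mono1[OF *, of "q ^ card (pairs V)"] by (simp only: mult.assoc)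
  finally show ?thesis using assms(3) by (simp add: mult.commute)
qed

text \<open>A union bound. The 3 extra bits leave probability at most 1/8, so that four kinds of bad
  event can be avoided at once.\<close>

lemma card_UN_le_of_exponential:
  fixes Q :: nat
  assumes "finite \<S>" "card \<S> \<le> 2 ^ b" "\<And>S. S \<in> \<S> \<Longrightarrow> 2 ^ (b + 3) * card (B S) \<le> Q"
  shows "8 * card (\<Union>S\<in>\<S>. B S) \<le> Q"
proof -
  have "card (\<Union>S\<in>\<S>. B S) \<le> (\<Sum>S\<in>\<S>. card (B S))" by (rule card_UN_le[OF assms(1)])
  then have "2 ^ (b + 3) * card (\<Union>S\<in>\<S>. B S) \<le> (\<Sum>S\<in>\<S>. 2 ^ (b + 3) * card (B S))"
    by (simp only: sum_distrib_left[symmetric] mult_le_mono2)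
  also have "\<dots> \<le> (\<Sum>S\<in>\<S>. Q)" by (rule sum_mono) (rule assms(3))
  also have "\<dots> \<le> 2 ^ b * Q" using assms(2) by simp
  finally show ?thesis by (simp add: power_add)
qed

lemma card_subsets_le:
  assumes "finite V" "card V \<le> 2 ^ a"
  shows "card {S. S \<subseteq> V \<and> card S = k} \<le> 2 ^ (a * k)"
proof (cases "k \<le> card V")
  case True
  have "card {S. S \<subseteq> V \<and> card S = k} = card V choose k" by (rule n_subsets[OF assms(1)])
  also have "\<dots> \<le> card V ^ k" by (rule binomial_le_pow[OF True])
  also have "\<dots> \<le> (2 ^ a) ^ k" by (rule power_mono) (use assms in auto)
  finally show ?thesis by (simp add: power_mult)
next
  case False
  then have none: "{S. S \<subseteq> V \<and> card S = k} = {}" using card_mono[OF assms(1)] by auto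
  show ?thesis unfolding none by simp
qed

lemma cliques_everywhereI:
  assumes "\<And>U. U \<subseteq> V \<Longrightarrow> card U = m \<Longrightarrow> \<exists>K\<subseteq>U. is_clique E K \<and> card K \<ge> r"
  shows "cliques_everywhere V E m r"
  unfolding cliques_everywhere_def
proof (intro allI impI)
  fix U assume U: "U \<subseteq> V" "m \<le> card U"
  obtain T where "T \<subseteq> U" "card T = m" using obtain_subset_with_card_n[OF U(2)] by blast
  then show "\<exists>K\<subseteq>U. is_clique E K \<and> card K \<ge> r" using assms[of T] U by blast
qed

text \<open>Flipping with probability 1/R^2 is rare enough to spare some \<open>R\<close>-clique in
  every set of size \<open>8 * a * m ^ 3\<close>, yet frequent enough to break all homogeneous sets
  of size \<open>4 * R\<^sup>2 * a\<close>. Symmetry survives because a flip depends on the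
  unordered pair.\<close>

lemma exists_perturbation:
  assumes V: "finite V" "card V \<le> 2 ^ a" and "a \<ge> 2" "R \<ge> 2" "m \<ge> 1"
    and sym: "\<And>x y. x \<in> V \<Longrightarrow> y \<in> V \<Longrightarrow> E x y \<Longrightarrow> E y x"
    and "cliques_everywhere V E m R" "cliques_everywhere V (\<lambda>x y. \<not> E x y) m R"
  obtains E' where "\<And>x y. x \<in> V \<Longrightarrow> y \<in> V \<Longrightarrow> E' x y \<Longrightarrow> E' y x"
    "cliques_everywhere V E' (4 * R\<^sup>2 * a) 2" "cliques_everywhere V (\<lambda>x y. \<not> E' x y) (4 * R\<^sup>2 * a) 2"
    "cliques_everywhere V E' (8 * a * m ^ 3) R" "cliques_everywhere V (\<lambda>x y. \<not> E' x y) (8 * a * m ^ 3) R"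
proof -
  define q where "q = R\<^sup>2"
  define h where "h = 4 * q * a"
  define M where "M = 8 * a * m ^ 3"
  define Q where "Q = q ^ card (pairs V)"
  define \<Omega> where "\<Omega> = pairs V \<rightarrow>\<^sub>E {..<q}"
  \<comment> \<open>\<open>B1 F\<close>: flips that turn some \<open>h\<close>-set into a clique.
    \<open>B2 F\<close>: flips that leave some \<open>M\<close>-set without an
    \<open>R\<close>-clique.\<close>
  define B1 where "B1 F = (\<Union>S\<in>{S. S \<subseteq> V \<and> card S = h}. {f \<in> \<Omega>. is_clique (flip F f) S})" for F
  define B2 where "B2 F = (\<Union>U\<in>{U. U \<subseteq> V \<and> card U = M}.
    {f \<in> \<Omega>. \<not> (\<exists>K\<subseteq>U. is_clique (flip F f) K \<and> card K \<ge> R)})" for F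
  have "R * R \<ge> 2 * 2" using \<open>R \<ge> 2\<close> by (intro mult_mono) auto
  then have q: "q \<ge> 4" by (simp add: q_def power2_eq_square)
  have "4 * q * a \<ge> 4 * 4 * 2" using q \<open>a \<ge> 2\<close> by (intro mult_mono) auto
  then have h: "h \<ge> 32" by (simp add: h_def)
  have finS: "finite {S. S \<subseteq> V \<and> card S = k}" for k by (rule finite_subset[of _ "Pow V"]) (use V in auto)
  have B1: "8 * card (B1 F) \<le> Q" for F
    unfolding B1_def
  proof (rule card_UN_le_of_exponential[OF finS card_subsets_le[OF V]])
    fix S assume S: "S \<in> {S. S \<subseteq> V \<and> card S = h}"
    have "a * h + 3 \<le> 2 * a * (h - 1)"
    proof -
      obtain h' where h': "h = h' + 32" using h le_Suc_ex by (metis add.commute)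
      have "a * h' \<ge> 0" by simp
      then show ?thesis using \<open>a \<ge> 2\<close> by (simp add: h' algebra_simps)
    qed
    then have "(2::nat) ^ (a * h + 3) \<le> 2 ^ (2 * a * (h - 1))" by (rule power_increasing) simp
    then have "2 ^ (a * h + 3) * card {f \<in> \<Omega>. is_clique (flip F f) S}
        \<le> 2 ^ (2 * a * (h - 1)) * card {f \<in> \<Omega>. is_clique (flip F f) S}" by (rule mult_le_mono1)
    also have "\<dots> \<le> Q"
      using card_flips_to_large_clique[of V S q a F] S V q unfolding Q_def \<Omega>_def h_def by simp
    finally show "2 ^ (a * h + 3) * card {f \<in> \<Omega>. is_clique (flip F f) S} \<le> Q" .
  qed
  have B2: "8 * card (B2 F) \<le> Q" if F: "cliques_everywhere V F m R" for F
    unfolding B2_def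
  proof (rule card_UN_le_of_exponential[OF finS card_subsets_le[OF V]])
    fix U assume U: "U \<in> {S. S \<subseteq> V \<and> card S = M}"
    let ?B = "{f \<in> \<Omega>. \<not> (\<exists>K\<subseteq>U. is_clique (flip F f) K \<and> card K \<ge> R)}"
    \<comment> \<open>With this \<open>A\<close>, \<open>2 * A * m\<^sup>2\<close> is
      \<open>M\<close>, and \<open>A * (A * m)\<close> is twice \<open>a * M\<close>, the exponent
      in the bound on the number of \<open>M\<close>-sets.\<close>
    define A where "A = 4 * a * m"
    have M: "M = 2 * A * m\<^sup>2" by (simp add: M_def A_def power2_eq_square power3_eq_cube)
    have "a * M + 3 \<le> A * (A * m)"
    proof -
      have "a * a * (m * m * m) \<ge> 2 * 2 * (1 * 1 * 1)"
        using \<open>a \<ge> 2\<close> \<open>m \<ge> 1\<close> by (intro mult_mono) auto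
      moreover have "A * (A * m) = 16 * (a * a * (m * m * m))" "a * M = 8 * (a * a * (m * m * m))"
        by (simp_all add: A_def M_def power3_eq_cube)
      ultimately show ?thesis by linarith
    qed
    then have "(2::nat) ^ (a * M + 3) \<le> 2 ^ (A * (A * m))" by (rule power_increasing) simp
    then have "2 ^ (a * M + 3) * card ?B \<le> 2 ^ (A * (A * m)) * card ?B" by (rule mult_le_mono1)
    also have "\<dots> \<le> Q"
      unfolding Q_def \<Omega>_def
      by (rule card_flips_without_clique[OF V(1) F]) (use U M in \<open>auto simp: q_def power2_eq_square\<close>)
    finally show "2 ^ (a * M + 3) * card ?B \<le> Q" .
  qed
  let ?E = "\<lambda>x y. \<not> E x y"
  have fin: "finite \<Omega>" unfolding \<Omega>_def by (intro finite_PiE finite_pairs V) simp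
  have "card \<Omega> = Q" unfolding \<Omega>_def Q_def by (simp add: card_PiE finite_pairs V)
  have "Q > 0" using q by (simp add: Q_def)
  have "card ((B1 E \<union> B1 ?E) \<union> (B2 E \<union> B2 ?E)) \<le> (card (B1 E) + card (B1 ?E)) + (card (B2 E) + card (B2 ?E))"
    by (intro order_trans[OF card_Un_le] add_mono card_Un_le)
  also have "\<dots> < card \<Omega>"
    using B1[of E] B1[of ?E] B2[of E] B2[of ?E] assms \<open>card \<Omega> = Q\<close> \<open>Q > 0\<close> by linarith
  finally have "\<not> \<Omega> \<subseteq> (B1 E \<union> B1 ?E) \<union> (B2 E \<union> B2 ?E)"
    using card_mono[of "(B1 E \<union> B1 ?E) \<union> (B2 E \<union> B2 ?E)" \<Omega>] fin finS
    by (auto simp: B1_def B2_def)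
  then obtain f where f: "f \<in> \<Omega>" "f \<notin> B1 E" "f \<notin> B1 ?E" "f \<notin> B2 E" "f \<notin> B2 ?E" by blast
  have large: "cliques_everywhere V (flip F f) M R" if "f \<notin> B2 F" for F
    by (rule cliques_everywhereI) (use that f(1) in \<open>unfold B2_def, blast\<close>)
  \<comment> \<open>An edge in every \<open>h\<close>-set means that no \<open>h\<close>-set is
    independent, so the event to avoid belongs to the complement of \<open>F\<close>.\<close>
  have two: "cliques_everywhere V (flip F f) h 2"
    if bad: "f \<notin> B1 (\<lambda>x y. \<not> F x y)" and sF: "\<And>x y. x \<in> V \<Longrightarrow> y \<in> V \<Longrightarrow> F x y \<Longrightarrow> F y x" for F
  proof (rule cliques_everywhereI)
    fix S assume S: "S \<subseteq> V" "card S = h"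
    then have "\<not> is_clique (flip (\<lambda>x y. \<not> F x y) f) S"
      using bad f(1) by (auto simp: B1_def)
    then obtain x y where xy: "x \<in> S" "y \<in> S" "x \<noteq> y" "flip F f x y"
      by (auto simp: is_clique_def flip_complement)
    then have "flip F f y x" using sF[of x y] sF[of y x] S by (auto simp: flip_def insert_commute)
    then have "is_clique (flip F f) {x, y}" "{x, y} \<subseteq> S" "card {x, y} \<ge> 2"
      using xy by (auto simp: is_clique_def)
    then show "\<exists>K\<subseteq>S. is_clique (flip F f) K \<and> card K \<ge> 2" by blast
  qed
  show ?thesis
  proof (rule that[of "flip E f"])
    show "flip E f y x" if "x \<in> V" "y \<in> V" "flip E f x y" for x y
      using that sym[of x y] sym[of y x] by (auto simp: flip_def insert_commute)
    show "cliques_everywhere V (flip E f) (4 * R\<^sup>2 * a) 2"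
      using two[OF f(3) sym] unfolding h_def q_def .
    show "cliques_everywhere V (\<lambda>x y. \<not> flip E f x y) (4 * R\<^sup>2 * a) 2"
    proof -
      have "cliques_everywhere V (flip ?E f) h 2"
        by (rule two) (use f(2) sym in auto)
      then show ?thesis unfolding flip_complement h_def q_def .
    qed
    show "cliques_everywhere V (flip E f) (8 * a * m ^ 3) R"
      using large[OF f(4)] unfolding M_def .
    show "cliques_everywhere V (\<lambda>x y. \<not> flip E f x y) (8 * a * m ^ 3) R"
      using large[OF f(5)] unfolding flip_complement M_def .
  qed
qed


subsection \<open>The amplification step\<close>

lemma locally_ramsey_iff_cliques_everywhere:
  "locally_ramsey V E m r \<longleftrightarrow>
     cliques_everywhere V E (nat \<lceil>m\<rceil>) (nat \<lceil>r\<rceil>) \<and> cliques_everywhere V (\<lambda>x y. \<not> E x y) (nat \<lceil>m\<rceil>) (nat \<lceil>r\<rceil>)"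
  unfolding locally_ramsey_def cliques_everywhere_def is_indep_iff_is_clique nat_ceiling_le_eq
  by blast

text \<open>Perturb the given graph, take its \<open>k\<close>-th lexicographic power, which has at
  least \<open>N\<close> vertices, and restrict it to \<open>N\<close> of them. As
  \<open>r \<le> 2 ^ s\<close>, \<open>s\<close> doublings suffice.\<close>

lemma locally_ramsey_amplify:
  fixes E :: "nat \<Rightarrow> nat \<Rightarrow> bool"
  assumes E: "simple_graph {..<2 ^ a} E" "locally_ramsey {..<2 ^ a} E (real m) r"
    and "a \<ge> 2" "r \<ge> 2" "m \<ge> 1" "r \<le> 2 ^ s" "N \<le> 2 ^ (a * k)"
    and m': "real ((4 * (nat \<lceil>r\<rceil>)\<^sup>2 * a + 1) ^ k * (8 * a * m ^ 3) ^ s) \<le> m'"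
  shows "\<exists>E' :: nat \<Rightarrow> nat \<Rightarrow> bool. simple_graph {..<N} E' \<and> locally_ramsey {..<N} E' m' r"
proof -
  define V where "V = {..<(2::nat) ^ a}"
  define R where "R = nat \<lceil>r\<rceil>"
  define M where "M = 8 * a * m ^ 3"
  define L where "L = {xs. set xs \<subseteq> V \<and> length xs = k}"
  have V: "finite V" "card V \<le> 2 ^ a" by (simp_all add: V_def)
  have "R \<ge> 2" using \<open>r \<ge> 2\<close> unfolding R_def by linarith
  have ce: "cliques_everywhere V E m R" "cliques_everywhere V (\<lambda>x y. \<not> E x y) m R"
    using E(2) unfolding locally_ramsey_iff_cliques_everywhere V_def R_def by simp_all
  have "E y x" if "x \<in> V" "y \<in> V" "E x y" for x y
    using E(1) that unfolding simple_graph_def V_def by blast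
  then obtain F where sym: "\<And>x y. x \<in> V \<Longrightarrow> y \<in> V \<Longrightarrow> F x y \<Longrightarrow> F y x"
    and F: "cliques_everywhere V F (4 * R\<^sup>2 * a) 2" "cliques_everywhere V (\<lambda>x y. \<not> F x y) (4 * R\<^sup>2 * a) 2"
    "cliques_everywhere V F M R" "cliques_everywhere V (\<lambda>x y. \<not> F x y) M R"
    using exists_perturbation[OF V \<open>a \<ge> 2\<close> \<open>R \<ge> 2\<close> \<open>m \<ge> 1\<close> _ ce] unfolding M_def by blast
  have "8 * a * m ^ 3 \<ge> 8 * 2 * 1 ^ 3"
    using \<open>a \<ge> 2\<close> \<open>m \<ge> 1\<close> by (intro mult_mono power_mono) auto
  moreover have "(2::nat) \<le> 8 * 2 * 1 ^ 3" by simp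
  ultimately have "M \<ge> 2" unfolding M_def by (rule order_trans[rotated])
  define m0 where "m0 = (4 * R\<^sup>2 * a + 1) ^ k * M ^ s"
  have lex: "cliques_everywhere L (lex_power F) m0 (min (2 ^ s) R)"
    "cliques_everywhere L (lex_power (\<lambda>x y. \<not> F x y)) m0 (min (2 ^ s) R)"
    unfolding L_def m0_def
    by (rule cliques_everywhere_lex_power[OF V(1) F(1,3) \<open>M \<ge> 2\<close>])
      (rule cliques_everywhere_lex_power[OF V(1) F(2,4) \<open>M \<ge> 2\<close>])
  have "finite L" unfolding L_def by (rule finite_lists_length_eq[OF V(1)])
  have "card L = 2 ^ (a * k)"
    unfolding L_def card_lists_length_eq[OF V(1)] by (simp add: V_def power_mult)
  then have "card {..<N} \<le> card L" using assms by simp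
  then obtain \<phi> where \<phi>: "\<phi> ` {..<N} \<subseteq> L" "inj_on \<phi> {..<N}"
    using card_le_inj[OF finite_lessThan \<open>finite L\<close>] by blast
  define E' where "E' x y = lex_power F (\<phi> x) (\<phi> y)" for x y
  \<comment> \<open>Stated for arbitrary \<open>G\<close> and \<open>G'\<close> to serve both
    colours; agreement is asked only off the diagonal, where complement and power commute.\<close>
  have pull: "\<exists>K\<subseteq>U. is_clique G' K \<and> r \<le> real (card K)"
    if G: "cliques_everywhere L G m0 (min (2 ^ s) R)"
      and G': "\<And>x y. x \<in> {..<N} \<Longrightarrow> y \<in> {..<N} \<Longrightarrow> x \<noteq> y \<Longrightarrow> G' x y \<longleftrightarrow> G (\<phi> x) (\<phi> y)"
      and U: "U \<subseteq> {..<N}" "m' \<le> real (card U)" for G G' U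
  proof -
    have injU: "inj_on \<phi> U" using \<phi>(2) U(1) by (rule inj_on_subset)
    have "real m0 \<le> real (card U)"
      using m' U(2) unfolding m0_def M_def R_def by linarith
    then have "m0 \<le> card (\<phi> ` U)" using card_image[OF injU] by simp
    moreover have "\<phi> ` U \<subseteq> L" using \<phi>(1) U(1) by blast
    ultimately obtain C where C: "C \<subseteq> \<phi> ` U" "is_clique G C" "card C = min (2 ^ s) R"
      using cliques_everywhereD[OF G] by metis
    obtain K where K: "K \<subseteq> U" "C = \<phi> ` K" using C(1) by (meson subset_imageE)
    have "card K = min (2 ^ s) R" using C(3) card_image[OF inj_on_subset[OF injU K(1)]] K(2) by simp
    moreover have "r \<le> real R" unfolding R_def by linarith
    ultimately have "r \<le> real (card K)" using \<open>r \<le> 2 ^ s\<close> by (simp add: min_def)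
    moreover have "is_clique G' K"
      unfolding is_clique_def
    proof (intro ballI impI)
      fix x y assume xy: "x \<in> K" "y \<in> K" "x \<noteq> y"
      then have "x \<in> {..<N}" "y \<in> {..<N}" using K(1) U(1) by blast+
      moreover have "\<phi> x \<noteq> \<phi> y" using xy K(1) injU by (metis inj_onD subsetD)
      then have "G (\<phi> x) (\<phi> y)" using C(2) xy unfolding K(2) is_clique_def by simp
      ultimately show "G' x y" using G' xy(3) by simp
    qed
    ultimately show ?thesis using K(1) by blast
  qed
  have inL: "\<phi> x \<in> L" if "x \<in> {..<N}" for x using that \<phi>(1) by blast
  have "E' y x" if "x \<in> {..<N}" "y \<in> {..<N}" "E' x y" for x y
    using lex_power_sym[of "\<phi> x" "\<phi> y" V F] inL[OF that(1)] inL[OF that(2)] that(3) sym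
    unfolding E'_def L_def by simp
  then have "simple_graph {..<N} E'"
    unfolding simple_graph_def by (simp add: E'_def lex_power_irrefl)
  moreover have "(\<not> E' x y) \<longleftrightarrow> lex_power (\<lambda>x y. \<not> F x y) (\<phi> x) (\<phi> y)"
    if "x \<in> {..<N}" "y \<in> {..<N}" "x \<noteq> y" for x y
  proof -
    have "\<phi> x \<noteq> \<phi> y" using that \<phi>(2) by (metis inj_onD)
    then show ?thesis
      using lex_power_complement[of "\<phi> x" "\<phi> y" F] inL[OF that(1)] inL[OF that(2)]
      unfolding E'_def L_def by simp
  qed
  then have "locally_ramsey {..<N} E' m' r"
    unfolding locally_ramsey_def is_indep_iff_is_clique
    using pull[OF lex(1), of E'] pull[OF lex(2), of "\<lambda>x y. \<not> E' x y"] by (simp add: E'_def)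
  ultimately show ?thesis by blast
qed

section \<open>Exponent arithmetic and the induction on \<open>t\<close>\<close>

lemma nine_mult_power_le:
  fixes p :: nat
  assumes "p \<ge> 1"
  shows "9 * real p ^ (2 * p) \<le> real (Suc p) ^ (2 * Suc p)"
proof (cases "p = 1")
  case False
  then have "real (Suc p) ^ 2 \<ge> 3 ^ 2" using assms by (intro power_mono) auto
  moreover have "real (Suc p) ^ (2 * p) \<ge> real p ^ (2 * p)" by (intro power_mono) auto
  ultimately have "3 ^ 2 * real p ^ (2 * p) \<le> real (Suc p) ^ 2 * real (Suc p) ^ (2 * p)"
    by (intro mult_mono) auto
  then show ?thesis by (simp add: power2_eq_square)
qed simp

text \<open>The base-2 logarithm of the threshold after amplification. Here \<open>x\<close> is the
  \<open>t\<close>-th root of log N, \<open>\<rho>\<close> is log r, \<open>\<mu>\<close> comes from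
  the previous case, and \<open>lh\<close>, \<open>lM\<close> are the logarithms of the costs per
  level and per doubling.\<close>

lemma exponent_recursion:
  fixes x \<rho> \<mu> k s lh lM :: real and p :: nat
  assumes "p \<ge> 1" "x \<ge> 8" "\<rho> \<ge> 2" "0 \<le> k" "k \<le> 9 / 8 * x" "0 \<le> s" "s \<le> 3 / 2 * \<rho>"
    and "lh \<le> 5 * \<rho>" "lM \<le> 6 + \<rho> / 2 + 3 * \<mu>" "0 \<le> \<mu>" "\<mu> \<le> real p ^ (2 * p) * \<rho> ^ p * (9 / 8 * x)"
  shows "k * lh + s * lM \<le> real (Suc p) ^ (2 * Suc p) * \<rho> ^ Suc p * x"
proof -
  define c where "c = real p ^ (2 * p)"
  define z where "z = c * (\<rho> ^ Suc p * x)"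
  have c: "c \<ge> 1" unfolding c_def using assms by (intro one_le_power) simp
  have "\<rho> ^ 2 \<le> \<rho> ^ Suc p" using assms by (intro power_increasing) auto
  then have "\<rho> ^ 2 * x \<le> \<rho> ^ Suc p * x" using assms by (intro mult_right_mono) auto
  also have "\<dots> \<le> z" unfolding z_def using c assms mult_right_mono[of 1 c "\<rho> ^ Suc p * x"] by simp
  finally have z: "\<rho>\<^sup>2 * x \<le> z" .
  have "2 * \<rho> \<le> \<rho>\<^sup>2" using assms by (simp add: power2_eq_square)
  then have r1: "2 * \<rho> * x \<le> \<rho>\<^sup>2 * x" using assms by (intro mult_right_mono) auto
  have r2: "\<rho>\<^sup>2 * 8 \<le> \<rho>\<^sup>2 * x" using assms by (intro mult_left_mono) auto
  have "k * lh \<le> k * (5 * \<rho>)" using assms by (intro mult_left_mono) auto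
  also have "\<dots> \<le> (9 / 8 * x) * (5 * \<rho>)" using assms by (intro mult_right_mono) auto
  finally have t1: "k * lh \<le> 45 / 16 * z" using r1 z by (simp add: algebra_simps)
  have "s * lM \<le> s * (6 + \<rho> / 2 + 3 * \<mu>)" using assms by (intro mult_left_mono) auto
  also have "\<dots> \<le> (3 / 2 * \<rho>) * (6 + \<rho> / 2 + 3 * \<mu>)" using assms by (intro mult_right_mono) auto
  also have "\<dots> = 9 * \<rho> + 3 / 4 * \<rho>\<^sup>2 + 9 / 2 * (\<rho> * \<mu>)" by (simp add: algebra_simps power2_eq_square)
  finally have t2: "s * lM \<le> 9 * \<rho> + 3 / 4 * \<rho>\<^sup>2 + 9 / 2 * (\<rho> * \<mu>)" .
  have "\<rho> * \<mu> \<le> \<rho> * (c * \<rho> ^ p * (9 / 8 * x))" unfolding c_def using assms by (intro mult_left_mono) auto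
  also have "\<dots> = 9 / 8 * z" by (simp add: z_def)
  finally have "\<rho> * \<mu> \<le> 9 / 8 * z" .
  moreover have "z \<ge> 0" using z r2 zero_le_power2[of \<rho>] by linarith
  \<comment> \<open>The level term gives 45/16 and the \<open>\<mu>\<close> term 81/16. As
    \<open>x \<ge> 8\<close> makes \<open>\<rho>\<^sup>2\<close> at most \<open>z\<close>/8, the
    remaining terms fit below 9; the growth from \<open>p ^ (2 * p)\<close> to the next such power
    absorbs the 9.\<close>
  ultimately have "k * lh + s * lM \<le> 9 * z"
    using t1 t2 z r1 r2 \<open>2 * \<rho> \<le> \<rho>\<^sup>2\<close> by linarith
  also have "\<dots> = (9 * c) * (\<rho> ^ Suc p * x)" by (simp add: z_def)
  also have "\<dots> \<le> real (Suc p) ^ (2 * Suc p) * (\<rho> ^ Suc p * x)"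
    unfolding c_def using nine_mult_power_le[OF assms(1)] assms by (intro mult_right_mono) auto
  finally show ?thesis by (simp add: mult.assoc)
qed

lemma locally_ramsey_exists_trivial:
  assumes "m > real N"
  shows "\<exists>E :: nat \<Rightarrow> nat \<Rightarrow> bool. simple_graph {..<N} E \<and> locally_ramsey {..<N} E m r"
proof -
  have "\<not> m \<le> real (card U)" if "U \<subseteq> {..<N}" for U
    using card_mono[OF finite_lessThan that] assms by simp
  then have "simple_graph {..<N} (\<lambda>_ _. False) \<and> locally_ramsey {..<N} (\<lambda>_ _. False) m r"
    by (simp add: simple_graph_def locally_ramsey_def)
  then show ?thesis by blast
qed

text \<open>Starting at \<open>t = 1\<close> makes the base case vacuous: log m is at least 2 log N.
  There the last hypothesis gives only log r \<ge> 1, so log r \<ge> 2 is carried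
  separately.\<close>

lemma locally_ramsey_exists:
  fixes r :: real
  assumes "t \<ge> 1" "N \<ge> 4" "m > 0" "r > 0" "log 2 r \<ge> 2"
    and "log 2 m \<ge> real t ^ (2 * t) * (log 2 r) ^ t * (log 2 (real N)) powr (1 / real t)"
    and "log 2 r \<ge> real t * log 2 (log 2 (real N))"
  shows "\<exists>E :: nat \<Rightarrow> nat \<Rightarrow> bool. simple_graph {..<N} E \<and> locally_ramsey {..<N} E m r"
  using assms
proof (induction t arbitrary: N m rule: nat_induct_at_least)
  case base
  define n where "n = log 2 (real N)"
  have "n \<ge> log 2 4" unfolding n_def using base by (subst log_le_cancel_iff) auto
  then have "n > 0" using log_of_power_eq[of 4 2 2] by simp
  then have "n < 2 * n" by simp
  also have "\<dots> \<le> log 2 r * n" using base \<open>n > 0\<close> by (intro mult_right_mono) auto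
  also have "\<dots> \<le> log 2 m" using base \<open>n > 0\<close> by (simp add: n_def)
  finally have "real N < m" using base by (simp add: n_def)
  then show ?case by (rule locally_ramsey_exists_trivial)
next
  case (Suc p)
  define t where "t = Suc p"
  define n where "n = log 2 (real N)"
  define \<rho> where "\<rho> = log 2 r"
  have \<rho>: "\<rho> \<ge> 2" "real t * log 2 n \<le> \<rho>" using Suc.prems by (simp_all add: \<rho>_def n_def t_def)
  have hm: "real t ^ (2 * t) * \<rho> ^ t * n powr (1 / real t) \<le> log 2 m"
    using Suc.prems unfolding t_def \<rho>_def n_def by blast
  have "t \<ge> 2" using Suc.hyps by (simp add: t_def)
  have "n \<ge> log 2 4" unfolding n_def using Suc.prems by (subst log_le_cancel_iff) auto
  then have n: "n \<ge> 2" using log_of_power_eq[of 4 2 2] by simp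
  show ?case
  proof (cases "m > real N")
    case True
    then show ?thesis by (rule locally_ramsey_exists_trivial)
  next
    case False
    define x where "x = n powr (1 / real t)"
    have "x > 0" using n by (simp add: x_def)
    have "x ^ t = x powr real t" using \<open>x > 0\<close> by (simp add: powr_realpow)
    also have "\<dots> = n" using n \<open>t \<ge> 2\<close> by (simp add: x_def powr_powr)
    finally have xt: "x ^ t = n" .
    have "log 2 m \<le> n" unfolding n_def using False Suc.prems by (subst log_le_cancel_iff) auto
    then have "real t ^ (2 * t) * \<rho> ^ t * x \<le> x ^ p * x"
      using hm xt by (simp add: x_def t_def mult.commute)
    then have xp: "real t ^ (2 * t) * \<rho> ^ t \<le> x ^ p" using \<open>x > 0\<close> by simp
    \<comment> \<open>With \<open>m\<close> at most \<open>N\<close> the hypothesis forces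
      \<open>x\<close> to be large, and \<open>x \<ge> 8\<close> bounds the cost of each later
      rounding by a factor 9/8.\<close>
    have "(8::real) ^ p \<le> 8 ^ t" by (rule power_increasing) (auto simp: t_def)
    also have "(8::real) ^ t = (2 ^ 2) ^ t * 2 ^ t" by (simp flip: power_mult_distrib)
    also have "\<dots> \<le> (real t ^ 2) ^ t * \<rho> ^ t"
      using \<open>t \<ge> 2\<close> \<rho>(1) by (intro mult_mono power_mono) auto
    also have "\<dots> \<le> x ^ p" using xp by (simp add: power_mult)
    finally have "x \<ge> 8" using \<open>x > 0\<close> Suc.hyps power_mono_iff[of 8 x p] by simp
    have "x ^ 1 \<le> x ^ p" using \<open>x \<ge> 8\<close> Suc.hyps by (intro power_increasing) auto
    then have "x ^ p \<ge> 8" using \<open>x \<ge> 8\<close> by simp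
    \<comment> \<open>Since log N is \<open>x ^ p * x\<close>, a base graph on \<open>2 ^ a\<close>
      vertices and a power of depth \<open>k\<close> reach \<open>N\<close> vertices.\<close>
    define k where "k = nat \<lceil>x\<rceil>"
    define a where "a = nat \<lceil>x ^ p\<rceil>"
    have k: "x \<le> real k" "real k \<le> 9 / 8 * x" unfolding k_def using \<open>x \<ge> 8\<close> by linarith+
    have a: "x ^ p \<le> real a" "real a \<le> 9 / 8 * x ^ p" unfolding a_def using \<open>x ^ p \<ge> 8\<close> by linarith+
    have "real a \<ge> 8" using a \<open>x ^ p \<ge> 8\<close> by linarith
    \<comment> \<open>From \<open>real a \<le> n\<close> follows that \<open>t\<close> times log a
      is at most \<open>\<rho>\<close>: this gives the second condition of the case \<open>p\<close>
      and hides log a in \<open>\<rho> / 2\<close>.\<close>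
    have "9 / 8 * x ^ p \<le> x * x ^ p" using \<open>x \<ge> 8\<close> by (intro mult_right_mono) auto
    then have "real a \<le> n" using a xt by (simp add: t_def)
    have "log 2 (real a) \<le> log 2 n" using \<open>real a \<le> n\<close> \<open>real a \<ge> 8\<close> by (subst log_le_cancel_iff) auto
    have "log 2 (real a) \<ge> 0" using \<open>real a \<ge> 8\<close> by simp
    have la_t: "real t * log 2 (real a) \<le> \<rho>"
      using \<rho>(2) mult_left_mono[OF \<open>log 2 (real a) \<le> log 2 n\<close>, of "real t"] by linarith
    have la: "log 2 (real a) \<le> \<rho> / 2"
      using la_t mult_right_mono[of 2 "real t" "log 2 (real a)"] \<open>t \<ge> 2\<close> \<open>log 2 (real a) \<ge> 0\<close> by simp
    have la_p: "real p * log 2 (real a) \<le> \<rho>"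
      using la_t mult_right_mono[of "real p" "real t" "log 2 (real a)"] \<open>log 2 (real a) \<ge> 0\<close>
      by (simp add: t_def)
    have "n \<le> real (a * k)"
    proof -
      have "x ^ p * x \<le> real a * real k" using a k \<open>x > 0\<close> by (intro mult_mono) auto
      then show ?thesis using xt by (simp add: t_def mult.commute)
    qed
    then have "2 powr n \<le> 2 powr real (a * k)" by (intro powr_mono) auto
    then have "real N \<le> real (2 ^ (a * k))"
      using Suc.prems by (simp add: n_def powr_realpow del: of_nat_mult)
    then have N: "N \<le> 2 ^ (a * k)" by (simp only: of_nat_le_iff)
    \<comment> \<open>The exponent that the case \<open>p\<close> demands for \<open>2 ^ a\<close>
      vertices.\<close>
    define \<mu> where "\<mu> = real p ^ (2 * p) * \<rho> ^ p * real a powr (1 / real p)"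
    have "\<mu> \<ge> 0" using \<rho> by (simp add: \<mu>_def)
    have "real a powr (1 / real p) \<le> 9 / 8 * x"
    proof -
      have "(9 / 8 :: real) \<le> (9 / 8) ^ p" using self_le_power[of "9/8 :: real" p] Suc.hyps by simp
      then have "9 / 8 * x ^ p \<le> (9 / 8 * x) ^ p"
        unfolding power_mult_distrib using \<open>x > 0\<close> by (intro mult_right_mono) auto
      then have "real a \<le> (9 / 8 * x) ^ p" using a by linarith
      then have "real a powr (1 / real p) \<le> ((9 / 8 * x) ^ p) powr (1 / real p)"
        by (intro powr_mono2) auto
      also have "\<dots> = ((9 / 8 * x) powr real p) powr (1 / real p)"
        using \<open>x > 0\<close> by (subst powr_realpow) auto
      also have "\<dots> = 9 / 8 * x" using \<open>x > 0\<close> Suc.hyps unfolding powr_powr by simp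
      finally show ?thesis .
    qed
    then have \<mu>_le: "\<mu> \<le> real p ^ (2 * p) * \<rho> ^ p * (9 / 8 * x)"
      unfolding \<mu>_def using \<rho> by (intro mult_left_mono) auto
    define m1 where "m1 = nat \<lceil>2 powr \<mu>\<rceil>"
    have "2 powr \<mu> \<ge> 1" using \<open>\<mu> \<ge> 0\<close> by (simp add: ge_one_powr_ge_zero)
    have "m1 \<ge> 1" "2 powr \<mu> \<le> real m1" "real m1 \<le> 2 powr \<mu> * 2"
      unfolding m1_def using \<open>2 powr \<mu> \<ge> 1\<close> by linarith+
    have "log 2 (2 powr \<mu>) \<le> log 2 (real m1)"
      using \<open>m1 \<ge> 1\<close> \<open>2 powr \<mu> \<le> real m1\<close> by (subst log_le_cancel_iff) auto
    then have m1_ge: "\<mu> \<le> log 2 (real m1)" by simp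
    have "log 2 (real m1) \<le> log 2 (2 powr \<mu> * 2)"
      using \<open>m1 \<ge> 1\<close> \<open>real m1 \<le> 2 powr \<mu> * 2\<close> by (subst log_le_cancel_iff) auto
    then have m1_le: "log 2 (real m1) \<le> \<mu> + 1" by (simp add: log_mult)
    have log_a: "log 2 (real (2 ^ a)) = real a" by (simp add: log_nat_power)
    have "(2::nat) ^ 2 \<le> 2 ^ a" using \<open>real a \<ge> 8\<close> by (intro power_increasing) auto
    then have "\<exists>E :: nat \<Rightarrow> nat \<Rightarrow> bool. simple_graph {..<2 ^ a} E \<and> locally_ramsey {..<2 ^ a} E (real m1) r"
      using Suc.IH[of "2 ^ a" "real m1"] Suc.prems \<open>m1 \<ge> 1\<close> m1_ge la_p
      unfolding log_a \<mu>_def \<rho>_def by simp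
    then obtain E :: "nat \<Rightarrow> nat \<Rightarrow> bool"
      where E: "simple_graph {..<2 ^ a} E" "locally_ramsey {..<2 ^ a} E (real m1) r" by blast
    \<comment> \<open>The number of doublings needed to reach \<open>r\<close>; rounding costs a
      factor at most 3/2 because \<open>\<rho> \<ge> 2\<close>.\<close>
    define s where "s = nat \<lceil>\<rho>\<rceil>"
    have s: "\<rho> \<le> real s" "real s \<le> 3 / 2 * \<rho>" unfolding s_def using \<rho>(1) by linarith+
    have r: "r = 2 powr \<rho>" using Suc.prems by (simp add: \<rho>_def)
    have "2 powr 2 \<le> r" unfolding r using \<rho>(1) by (intro powr_mono) auto
    then have "r \<ge> 4" by simp
    have "r \<le> 2 powr real s" unfolding r using s by (intro powr_mono) auto
    then have rs: "r \<le> 2 ^ s" by (simp add: powr_realpow)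
    define R where "R = nat \<lceil>r\<rceil>"
    have R: "real R \<le> 2 * r" "real R \<ge> 1" unfolding R_def using \<open>r \<ge> 4\<close> by linarith+
    define h where "h = 4 * R\<^sup>2 * a + 1"
    define M where "M = 8 * a * m1 ^ 3"
    have lh: "log 2 (real h) \<le> 5 * \<rho>"
    proof -
      have "h > 0" by (simp add: h_def)
      have "1 * 1 \<le> (real R)\<^sup>2 * real a" using R \<open>real a \<ge> 8\<close> by (intro mult_mono one_le_power) auto
      moreover have "real h = 4 * ((real R)\<^sup>2 * real a) + 1" by (simp add: h_def)
      ultimately have "real h \<le> 8 * ((real R)\<^sup>2 * real a)" by linarith
      also have "\<dots> \<le> 8 * ((2 * r)\<^sup>2 * real a)"
        using R by (intro mult_left_mono mult_right_mono power_mono) auto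
      finally have "log 2 (real h) \<le> log 2 (2 ^ 5 * (r ^ 2 * real a))"
        using \<open>real a \<ge> 8\<close> \<open>r \<ge> 4\<close> by (subst log_le_cancel_iff) (auto simp: power_mult_distrib \<open>h > 0\<close>)
      also have "\<dots> = log 2 (2 ^ 5) + (log 2 (r ^ 2) + log 2 (real a))"
        using \<open>real a \<ge> 8\<close> \<open>r \<ge> 4\<close> by (subst log_mult; simp add: log_mult)
      \<comment> \<open>Here 5 is at most 5/2 of \<open>\<rho>\<close> and log a at most half of
        \<open>\<rho>\<close>, which adds up to \<open>5 * \<rho>\<close>.\<close>
      also have "\<dots> = 5 + (2 * \<rho> + log 2 (real a))"
        using \<open>r \<ge> 4\<close> by (simp add: log_nat_power \<rho>_def del: power_numeral)
      finally show ?thesis using la \<rho>(1) by linarith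
    qed
    have lM: "log 2 (real M) \<le> 6 + \<rho> / 2 + 3 * \<mu>"
    proof -
      have "log 2 (real M) = log 2 (2 ^ 3 * (real a * real m1 ^ 3))" by (simp add: M_def mult.assoc)
      also have "\<dots> = log 2 (2 ^ 3) + (log 2 (real a) + log 2 (real m1 ^ 3))"
        using \<open>real a \<ge> 8\<close> \<open>m1 \<ge> 1\<close> by (subst log_mult; simp add: log_mult)
      also have "\<dots> = 3 + (log 2 (real a) + 3 * log 2 (real m1))"
        using \<open>m1 \<ge> 1\<close> by (simp add: log_nat_power del: power_numeral)
      finally show ?thesis using la m1_le by linarith
    qed
    have "h > 0" "M > 0" using \<open>real a \<ge> 8\<close> \<open>m1 \<ge> 1\<close> by (auto simp: h_def M_def)
    then have "log 2 (real (h ^ k * M ^ s)) = real k * log 2 (real h) + real s * log 2 (real M)"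
      by (simp add: log_mult log_nat_power)
    also have "\<dots> \<le> real t ^ (2 * t) * \<rho> ^ t * x"
      unfolding t_def
      by (rule exponent_recursion[OF Suc.hyps(1) \<open>x \<ge> 8\<close> \<rho>(1) _ k(2) _ s(2) lh lM \<open>\<mu> \<ge> 0\<close> \<mu>_le]) auto
    also have "\<dots> \<le> log 2 m" using hm by (simp add: x_def)
    finally have "real (h ^ k * M ^ s) \<le> m"
      using \<open>h > 0\<close> \<open>M > 0\<close> Suc.prems(2) by (subst (asm) log_le_cancel_iff) auto
    then show ?thesis
      using locally_ramsey_amplify[OF E _ _ \<open>m1 \<ge> 1\<close> rs N] \<open>real a \<ge> 8\<close> \<open>r \<ge> 4\<close>
      unfolding h_def M_def R_def by simp
  qed
qed

theorem theorem3p2: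
  fixes t N :: nat and m r :: real
  assumes "t \<ge> 2" and "N \<ge> 4" and "m > 0" and "r > 0"
    and "log 2 m \<ge> real t ^ (2 * t) * (log 2 r) ^ t * (log 2 (real N)) powr (1 / real t)"
    and "log 2 r \<ge> real t * log 2 (log 2 (real N))"
  shows "\<exists>E :: nat \<Rightarrow> nat \<Rightarrow> bool. simple_graph {..<N} E \<and> locally_ramsey {..<N} E m r"
proof -
  \<comment> \<open>\<open>N \<ge> 4\<close> makes log log N at least 1, so log r is at least
    \<open>t\<close>, hence at least 2.\<close>
  have "log 2 4 \<le> log 2 (real N)" using assms by (subst log_le_cancel_iff) auto
  then have "2 \<le> log 2 (real N)" using log_of_power_eq[of 4 2 2] by simp
  then have "log 2 2 \<le> log 2 (log 2 (real N))" by (subst log_le_cancel_iff) auto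
  then have "real t * 1 \<le> real t * log 2 (log 2 (real N))" by (intro mult_left_mono) auto
  then have "2 \<le> log 2 r" using assms by linarith
  then show ?thesis using locally_ramsey_exists[of t N m r] assms by simp
qed

end
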